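(* Let $H\in(0,1)$ and let $B^1_H$, $B^2_H$ be independent fractional Brownian motions with Hurst parameter $H$. For the process $$J^1_F(t)=B^1_H\left(|B^2_H(t)|^{1/H}\right),\qquad t>0,$$ the distribution $$p^1(x,t)=2\int_0^\infty\frac{e^{-x^2/(2s^2)}}{\sqrt{2\pi s^2}}\,\frac{e^{-s^2/(2t^{2H})}}{\sqrt{2\pi t^{2H}}}\,ds=\frac{1}{\pi t^H}K_0\!\left(\frac{|x|}{t^H}\right),\qquad x\in\mathbb{R}\setminus\{0\},\ t>0,$$ solves the partial differential equation $$\frac{\partial}{\partial t}p^1=-Ht^{2H-1}\left(2\frac{\partial^2}{\partial x^2}+x\frac{\partial^3}{\partial x^3}\right)p^1=-Ht^{2H-1}\frac{\partial^2}{\partial x^2}\left(x\frac{\partial}{\partial x}p^1\right)$$ for all $x\neq0$, $t>0$.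
   Context: A fractional Brownian motion $B_H$ with Hurst parameter $H\in(0,1)$ is a centred Gaussian process with covariance $E\{B_H(s)B_H(t)\}=\frac12\left(|t|^{2H}+|s|^{2H}-|t-s|^{2H}\right)$. $K_0$ is the modified Bessel function $K_0(x)=\int_0^\infty s^{-1}e^{-\frac{x^2}{4s^2}-s^2}\,ds$, $x>0$.
   Formalization: The formal theorem also assumes that all sample paths of B^1_H are continuous; for a merely centred Gaussian process with this covariance, setting B^1_H to 0 at the random time |B^2_H(t)|^{1/H} keeps all finite-dimensional laws but makes J(t)=0, so p^1 is not its density. *)

theory Defs
  imports "HOL-Probability.Probability"
begin

text \<open>Degenerate (almost surely constant) variables count as Gaussian; this is needed because
  a fractional Brownian motion vanishes almost surely at time 0.\<close>

definition gaussian_rv :: "'a measure \<Rightarrow> ('a \<Rightarrow> real) \<Rightarrow> bool" where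
  "gaussian_rv M X \<longleftrightarrow> X \<in> borel_measurable M \<and>
     (\<exists>\<mu>. (AE \<omega> in M. X \<omega> = \<mu>) \<or>
        (\<exists>\<sigma>>0. distributed M lborel X (\<lambda>x. ennreal (normal_density \<mu> \<sigma> x))))"

definition gaussian_process :: "'a measure \<Rightarrow> real set \<Rightarrow> (real \<Rightarrow> 'a \<Rightarrow> real) \<Rightarrow> bool" where
  "gaussian_process M T X \<longleftrightarrow>
     (\<forall>F c. finite F \<and> F \<subseteq> T \<longrightarrow> gaussian_rv M (\<lambda>\<omega>. \<Sum>t\<in>F. c t * X t \<omega>))"

definition fractional_brownian_motion ::
    "'a measure \<Rightarrow> real \<Rightarrow> real set \<Rightarrow> (real \<Rightarrow> 'a \<Rightarrow> real) \<Rightarrow> bool" where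
  "fractional_brownian_motion M H T B \<longleftrightarrow>
     gaussian_process M T B \<and>
     (\<forall>t\<in>T. (LINT \<omega>|M. B t \<omega>) = 0) \<and>
     (\<forall>s\<in>T. \<forall>t\<in>T. (LINT \<omega>|M. B s \<omega> * B t \<omega>)
        = (\<bar>t\<bar> powr (2 * H) + \<bar>s\<bar> powr (2 * H) - \<bar>t - s\<bar> powr (2 * H)) / 2)"

text \<open>Independence of the processes as random elements of the product space over \<open>T\<close>, not merely
  independence at each fixed time.\<close>

definition independent_processes ::
    "'a measure \<Rightarrow> real set \<Rightarrow> (real \<Rightarrow> 'a \<Rightarrow> real) \<Rightarrow> (real \<Rightarrow> 'a \<Rightarrow> real) \<Rightarrow> bool" where
  "independent_processes M T X Y \<longleftrightarrow>
     prob_space.indep_var M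
       (PiM T (\<lambda>_. borel)) (\<lambda>\<omega>. \<lambda>t\<in>T. X t \<omega>)
       (PiM T (\<lambda>_. borel)) (\<lambda>\<omega>. \<lambda>t\<in>T. Y t \<omega>)"

definition iterated_fbm ::
    "real \<Rightarrow> (real \<Rightarrow> 'a \<Rightarrow> real) \<Rightarrow> (real \<Rightarrow> 'a \<Rightarrow> real) \<Rightarrow> real \<Rightarrow> 'a \<Rightarrow> real" where
  "iterated_fbm H B1 B2 t \<omega> = B1 (\<bar>B2 t \<omega>\<bar> powr (1 / H)) \<omega>"

definition bessel_K0 :: "real \<Rightarrow> real" where
  "bessel_K0 x = (LBINT s:{0<..}. 1 / s * exp (- (x\<^sup>2 / (4 * s\<^sup>2)) - s\<^sup>2))"

text \<open>At \<open>x = 0\<close> the integral diverges and \<open>p1\<close> takes the default value 0.\<close>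

definition p1 :: "real \<Rightarrow> real \<Rightarrow> real \<Rightarrow> real" where
  "p1 H x t = 2 * (LBINT s:{0<..}.
      exp (- x\<^sup>2 / (2 * s\<^sup>2)) / sqrt (2 * pi * s\<^sup>2) *
      (exp (- s\<^sup>2 / (2 * t powr (2 * H))) / sqrt (2 * pi * t powr (2 * H))))"

end

theory Submission
  imports Defs "HOL-Real_Asymp.Real_Asymp"
begin

text \<open>Conditionally on \<open>B2 t = b\<close>, the variable \<open>B1 (\<bar>b\<bar> powr (1 / H))\<close> is centred normal with
  variance \<open>b\<^sup>2\<close>, because the exponents \<open>1 / H\<close> and \<open>2 * H\<close> cancel. Hence \<open>iterated_fbm H B1 B2 t\<close>
  has the characteristic function of a product of two independent normal variables with standard
  deviations \<open>t powr H\<close> and \<open>1\<close>, and this product has density \<open>p1 H x t\<close>.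

  For the equation, \<open>\<integral> (1 / s)^n exp (- y / (4 s\<^sup>2) - s\<^sup>2) ds\<close> over \<open>s > 0\<close>, as a function of \<open>y\<close>, can be
  differentiated under the integral sign, and integrating the derivative of
  \<open>(1 / s)\<^sup>2 exp (- y / (4 s\<^sup>2) - s\<^sup>2)\<close> yields the Bessel equation. The partial differential
  equation follows from it together with the self-similarity of \<open>p1\<close>.\<close>

section \<open>Bessel-type integrals\<close>

text \<open>The mean value inequality on the ball bounds every difference quotient by
  \<open>g\<close>, so dominated convergence along an arbitrary sequence tending to \<open>y\<close>
  yields the derivative.\<close>

lemma DERIV_integral_dominated:
  fixes f f' :: "real \<Rightarrow> 'a \<Rightarrow> real"
  assumes r: "0 < r"
    and int: "\<And>z. z \<in> ball y r \<Longrightarrow> integrable M (f z)"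
    and der: "\<And>z s. z \<in> ball y r \<Longrightarrow> s \<in> space M \<Longrightarrow> ((\<lambda>z. f z s) has_real_derivative f' z s) (at z)"
    and bound: "\<And>z s. z \<in> ball y r \<Longrightarrow> s \<in> space M \<Longrightarrow> \<bar>f' z s\<bar> \<le> g s"
    and g: "integrable M g"
    and meas [measurable]: "f' y \<in> borel_measurable M"
  shows "((\<lambda>z. LINT s|M. f z s) has_real_derivative (LINT s|M. f' y s)) (at y)"
proof -
  have "((\<lambda>z. ((LINT s|M. f z s) - (LINT s|M. f y s)) / (z - y)) \<longlongrightarrow> (LINT s|M. f' y s))
      (at y within ball y r)"
    unfolding tendsto_at_iff_sequentially comp_def
  proof (intro allI impI)
    fix X :: "nat \<Rightarrow> real"
    assume X: "\<forall>i. X i \<in> ball y r - {y}" and lim: "X \<longlonglongrightarrow> y"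
    have y: "y \<in> ball y r" using r by simp
    have "(\<lambda>i. LINT s|M. (f (X i) s - f y s) / (X i - y)) \<longlonglongrightarrow> (LINT s|M. f' y s)"
    proof (rule integral_dominated_convergence[where w = g])
      fix i
      show "(\<lambda>s. (f (X i) s - f y s) / (X i - y)) \<in> borel_measurable M"
        using int[of "X i"] int[OF y] X by (auto dest: borel_measurable_integrable)
      show "AE s in M. norm ((f (X i) s - f y s) / (X i - y)) \<le> g s"
      proof (rule AE_I2)
        fix s assume s: "s \<in> space M"
        have Xi: "X i \<in> ball y r" "X i \<noteq> y" using X by auto
        have "norm (f (X i) s - f y s) \<le> g s * norm (X i - y)"
          by (rule field_differentiable_bound[where S = "ball y r" and f' = "\<lambda>z. f' z s"])
             (use Xi y s der bound in \<open>auto intro: has_field_derivative_at_within\<close>)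
        then show "norm ((f (X i) s - f y s) / (X i - y)) \<le> g s"
          using Xi by (simp add: norm_divide divide_le_eq)
      qed
    next
      show "AE s in M. (\<lambda>i. (f (X i) s - f y s) / (X i - y)) \<longlonglongrightarrow> f' y s"
      proof (rule AE_I2)
        fix s assume s: "s \<in> space M"
        have "((\<lambda>z. (f z s - f y s) / (z - y)) \<longlongrightarrow> f' y s) (at y)"
          using der[OF y s] by (simp add: has_field_derivative_iff)
        then show "(\<lambda>i. (f (X i) s - f y s) / (X i - y)) \<longlonglongrightarrow> f' y s"
          using X lim unfolding tendsto_at_iff_sequentially comp_def by auto
      qed
    qed (use g in auto)
    moreover have "(LINT s|M. (f (X i) s - f y s) / (X i - y))
        = ((LINT s|M. f (X i) s) - (LINT s|M. f y s)) / (X i - y)" for i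
      using int[of "X i"] int[OF y] X by (subst integral_divide_zero, subst Bochner_Integration.integral_diff) auto
    ultimately show "(\<lambda>i. ((LINT s|M. f (X i) s) - (LINT s|M. f y s)) / (X i - y))
        \<longlonglongrightarrow> (LINT s|M. f' y s)" by (simp only:)
  qed
  then show ?thesis
    using r by (simp add: has_field_derivative_iff at_within_open[of y "ball y r"])
qed

text \<open>For \<open>y > 0\<close> this is (2 / z)^\<nu> K_\<nu>(z) with z = \<open>sqrt y\<close>
  and \<nu> = (n - 1) / 2. Taking \<open>y\<close> rather than z as the variable makes
  differentiation a mere shift of \<open>n\<close> by 2, up to a constant factor.\<close>

definition bessel_integral :: "nat \<Rightarrow> real \<Rightarrow> real" where
  "bessel_integral n y = (LBINT s:{0<..}. (1 / s) ^ n * exp (- (y / (4 * s\<^sup>2)) - s\<^sup>2))"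

text \<open>Controls the singularity at \<open>s = 0\<close>. A single term of the exponential
  series at \<open>z = c / s\<^sup>2\<close> bounds \<open>z ^ n\<close>; estimating
  \<open>(1 / s) ^ n\<close> by 1 plus its square avoids half-integer powers of
  \<open>z\<close>.\<close>

lemma inverse_power_times_exp_bounded:
  fixes c s :: real
  assumes c: "0 < c" and s: "0 < s"
  shows "(1 / s) ^ n * exp (- (c / s\<^sup>2)) \<le> 1 + fact n / c ^ n"
proof -
  define z where "z = c / s\<^sup>2"
  have z: "0 < z" using c s by (simp add: z_def)
  have "z ^ n / fact n \<le> exp z"
  proof -
    have "(\<Sum>i\<in>{n}. z ^ i /\<^sub>R fact i) \<le> exp z"
      unfolding exp_def by (intro sum_le_suminf summable_exp_generic) (use z in auto)
    then show ?thesis by (simp add: field_simps)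
  qed
  then have 1: "z ^ n \<le> fact n * exp z" by (simp add: field_simps)
  have "(1 / s) ^ n \<le> 1 + ((1 / s) ^ n)\<^sup>2"
  proof -
    have "0 \<le> (1 / s) ^ n" using s by simp
    then show ?thesis using sum_squares_bound[of "(1 / s) ^ n" 1] by simp
  qed
  also have "((1 / s) ^ n)\<^sup>2 = z ^ n / c ^ n"
    using c s by (simp add: z_def power_divide power_mult[symmetric] mult.commute)
  also have "\<dots> \<le> fact n / c ^ n * exp z"
    using divide_right_mono[OF 1, of "c ^ n"] c by simp
  finally have "(1 / s) ^ n * exp (- z) \<le> (1 + fact n / c ^ n * exp z) * exp (- z)"
    by (intro mult_right_mono) auto
  also have "\<dots> = exp (- z) + fact n / c ^ n" by (simp add: exp_minus field_simps)
  also have "\<dots> \<le> 1 + fact n / c ^ n" using z by simp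
  finally show ?thesis by (simp add: z_def)
qed

lemma set_integrable_bessel_integral:
  fixes y :: real
  assumes y: "0 < y"
  shows "set_integrable lborel {0<..} (\<lambda>s. (1 / s) ^ n * exp (- (y / (4 * s\<^sup>2)) - s\<^sup>2))"
proof -
  define C where "C = 1 + fact n / (y / 4) ^ n"
  \<comment> \<open>The majorant \<open>exp (- s\<^sup>2)\<close> is \<open>sqrt pi\<close> times
    the normal density with standard deviation \<open>1 / sqrt 2\<close>, which supplies its
    integrability.\<close>
  have "integrable lborel (\<lambda>s::real. C * (sqrt pi * normal_density 0 (1 / sqrt 2) s))"
    by (intro integrable_mult_right integrable_normal_density) auto
  moreover have "sqrt pi * normal_density 0 (1 / sqrt 2) s = exp (- s\<^sup>2)" for s :: real
    by (simp add: normal_density_def power_divide)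
  ultimately have g: "integrable lborel (\<lambda>s::real. C * exp (- s\<^sup>2))" by simp
  show ?thesis
    unfolding set_integrable_def
  proof (rule Bochner_Integration.integrable_bound[OF g])
    show "AE s in lborel. norm (indicator {0<..} s *\<^sub>R ((1 / s) ^ n * exp (- (y / (4 * s\<^sup>2)) - s\<^sup>2)))
        \<le> norm (C * exp (- s\<^sup>2))"
    proof (rule AE_I2)
      fix s :: real
      have C: "0 \<le> C" using y by (auto simp: C_def)
      show "norm (indicator {0<..} s *\<^sub>R ((1 / s) ^ n * exp (- (y / (4 * s\<^sup>2)) - s\<^sup>2)))
        \<le> norm (C * exp (- s\<^sup>2))"
      proof (cases "0 < s")
        case True
        have "(1 / s) ^ n * exp (- (y / (4 * s\<^sup>2))) \<le> C"
          using inverse_power_times_exp_bounded[of "y / 4" s n] y True by (simp add: C_def)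
        then have "(1 / s) ^ n * exp (- (y / (4 * s\<^sup>2))) * exp (- s\<^sup>2) \<le> C * exp (- s\<^sup>2)"
          by (rule mult_right_mono) simp
        moreover have "exp (- (y / (4 * s\<^sup>2)) - s\<^sup>2) = exp (- (y / (4 * s\<^sup>2))) * exp (- s\<^sup>2)"
          by (simp add: exp_add[symmetric])
        ultimately show ?thesis using True C by (simp only: indicator_simps greaterThan_iff) (simp add: abs_mult mult.assoc)
      qed (use C in simp)
    qed
  qed measurable
qed

text \<open>The exponential brings down the factor \<open>- (1 / (4 * s\<^sup>2))\<close>, hence the
  shift by 2. On the ball of radius \<open>y / 2\<close> around \<open>y\<close> the integrand
  decreases in the parameter, so its value at \<open>y / 2\<close> is an integrable
  majorant.\<close>

lemma DERIV_bessel_integral: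
  assumes y: "0 < y"
  shows "(bessel_integral n has_real_derivative - bessel_integral (n + 2) y / 4) (at y)"
proof -
  let ?f = "\<lambda>z s. indicator {0<..} s * ((1 / s) ^ n * exp (- (z / (4 * s\<^sup>2)) - s\<^sup>2)) :: real"
  let ?f' = "\<lambda>z s. - (1 / 4) * (indicator {0<..} s *
     ((1 / s) ^ (n + 2) * exp (- (z / (4 * s\<^sup>2)) - s\<^sup>2))) :: real"
  have pos: "0 < z" "y / 2 \<le> z" if "z \<in> ball y (y / 2)" for z
    using that y by (auto simp: dist_real_def abs_if split: if_splits)
  have int: "integrable lborel (\<lambda>s. indicator {0<..} s * ((1 / s) ^ k * exp (- (z / (4 * s\<^sup>2)) - s\<^sup>2)) :: real)"
    if "0 < z" for z k
    using set_integrable_bessel_integral[OF that, of k] by (simp add: set_integrable_def)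
  have "((\<lambda>z. LINT s|lborel. ?f z s) has_real_derivative (LINT s|lborel. ?f' y s)) (at y)"
  proof (rule DERIV_integral_dominated[where r = "y / 2" and f' = ?f' and
        g = "\<lambda>s. 1 / 4 * (indicator {0<..} s * ((1 / s) ^ (n + 2) * exp (- ((y / 2) / (4 * s\<^sup>2)) - s\<^sup>2)))"])
    show "((\<lambda>z. ?f z s) has_real_derivative ?f' z s) (at z)" for z s
    proof -
      have "((\<lambda>z. ?f z s) has_real_derivative
          indicator {0<..} s * ((1 / s) ^ n * (exp (- (z / (4 * s\<^sup>2)) - s\<^sup>2) * (- (1 / (4 * s\<^sup>2)))))) (at z)"
      proof (intro DERIV_cmult DERIV_fun_exp)
        show "((\<lambda>z. - (z / (4 * s\<^sup>2)) - s\<^sup>2) has_real_derivative - (1 / (4 * s\<^sup>2))) (at z)"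
          unfolding divide_inverse by (auto intro!: derivative_eq_intros)
      qed
      then show ?thesis by (rule DERIV_cong) (simp add: power_divide power2_eq_square mult_ac)
    qed
    show "\<bar>?f' z s\<bar> \<le> 1 / 4 * (indicator {0<..} s * ((1 / s) ^ (n + 2) * exp (- ((y / 2) / (4 * s\<^sup>2)) - s\<^sup>2)))"
      if "z \<in> ball y (y / 2)" for z s
    proof -
      have "y / 2 / (4 * s\<^sup>2) \<le> z / (4 * s\<^sup>2)"
        using pos[OF that] by (intro divide_right_mono) auto
      then have "exp (- (z / (4 * s\<^sup>2)) - s\<^sup>2) \<le> exp (- ((y / 2) / (4 * s\<^sup>2)) - s\<^sup>2)"
        by simp
      then show ?thesis
        by (auto simp: indicator_def abs_mult intro!: mult_left_mono divide_right_mono)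
    qed
  next
    show "integrable lborel (?f z)" if "z \<in> ball y (y / 2)" for z
      by (rule int[OF pos(1)[OF that]])
    show "integrable lborel (\<lambda>s. 1 / 4 * (indicator {0<..} s *
        ((1 / s) ^ (n + 2) * exp (- ((y / 2) / (4 * s\<^sup>2)) - s\<^sup>2))) :: real)"
      by (rule integrable_mult_right, rule int) (use y in simp)
  qed (use y in auto)
  moreover have "(LINT s|lborel. ?f z s) = bessel_integral n z" for z
    by (simp add: bessel_integral_def set_lebesgue_integral_def)
  moreover have "(LINT s|lborel. ?f' z s) = - bessel_integral (n + 2) z / 4" for z
    by (simp add: bessel_integral_def set_lebesgue_integral_def del: power_Suc)
  ultimately show ?thesis by (simp only:)
qed

text \<open>In classical terms this is the recurrence K_2(z) = K_0(z) + (2 / z) K_1(z) at z =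
  \<open>sqrt y\<close>. Since the indices 3 and 5 are multiples of the first and second derivatives
  of index 1, it is also Bessel's equation of order 0.\<close>

lemma bessel_integral_ode:
  assumes y: "0 < y"
  shows "y * bessel_integral 5 y / 4 = bessel_integral 3 y + bessel_integral 1 y"
proof -
  let ?E = "\<lambda>s::real. exp (- (y / (4 * s\<^sup>2)) - s\<^sup>2)"
  let ?F = "\<lambda>s::real. (1 / s)\<^sup>2 * ?E s"
  let ?h = "\<lambda>s::real. y / 2 * ((1 / s) ^ 5 * ?E s) - 2 * ((1 / s) ^ 3 * ?E s) - 2 * ((1 / s) ^ 1 * ?E s)"
  have m: "set_integrable lborel {0<..} (\<lambda>s. c * ((1 / s) ^ n * ?E s))" for c n
    by (intro set_integrable_mult_right set_integrable_bessel_integral y)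
  have int: "set_integrable lborel {0<..} ?h"
    by (intro set_integral_diff m)
  have "(LBINT s=0..\<infinity>. ?h s) = 0 - 0"
  proof (rule interval_integral_FTC_integrable[where F = ?F])
    fix s :: real assume "0 < ereal s"
    then have s: "0 < s" by simp
    have "(?F has_real_derivative 2 * (1 / s) * (- (1 / s)\<^sup>2) * ?E s
        + (1 / s)\<^sup>2 * (?E s * (y / 2 * (1 / s) ^ 3 - 2 * s))) (at s)"
      by (rule derivative_eq_intros refl | use s in simp; fail)+
         (use s in \<open>simp add: power_divide power2_eq_square power3_eq_cube mult.assoc\<close>)
    moreover have "2 * (1 / s) * (- (1 / s)\<^sup>2) * ?E s
        + (1 / s)\<^sup>2 * (?E s * (y / 2 * (1 / s) ^ 3 - 2 * s)) = ?h s"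
      using s by (simp add: power_divide right_diff_distrib eval_nat_numeral mult_ac)
    ultimately have "(?F has_real_derivative ?h s) (at s)" by simp
    then show "(?F has_vector_derivative ?h s) (at s)"
      by (simp add: has_real_derivative_iff_has_vector_derivative)
    show "isCont ?h s" using s by (auto intro!: continuous_intros)
  next
    show "set_integrable lborel (einterval 0 \<infinity>) ?h" using int by (simp add: zero_ereal_def)
    \<comment> \<open>At 0 the factor \<open>exp (- (y / (4 * s\<^sup>2)))\<close> beats the double
      pole because \<open>y > 0\<close>; at infinity every factor stays bounded and
      \<open>(1 / s)\<^sup>2\<close> tends to 0.\<close>
    have "(?F \<longlongrightarrow> 0) (at_right 0)" using y by real_asymp
    then show "((?F \<circ> real_of_ereal) \<longlongrightarrow> 0) (at_right 0)"
      by (simp add: zero_ereal_def ereal_tendsto_simps)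
    have "(?F \<longlongrightarrow> 0) at_top" using y by real_asymp
    then show "((?F \<circ> real_of_ereal) \<longlongrightarrow> 0) (at_left \<infinity>)"
      by (simp add: ereal_tendsto_simps)
  qed auto
  then have "(LBINT s:{0<..}. ?h s) = 0"
    by (simp add: interval_lebesgue_integral_0_infty)
  also have "(LBINT s:{0<..}. ?h s) = y / 2 * bessel_integral 5 y - 2 * bessel_integral 3 y - 2 * bessel_integral 1 y"
    by (simp only: set_integral_diff(2)[OF set_integral_diff(1)[OF m m] m]
        set_integral_diff(2)[OF m m] set_integral_mult_right bessel_integral_def)
  finally show ?thesis by simp
qed

section \<open>Reduction of \<open>bessel_K0\<close> and \<open>p1\<close> to Bessel-type
  integrals\<close>

lemma bessel_K0_eq_bessel_integral: "bessel_K0 x = bessel_integral 1 (x\<^sup>2)"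
  by (simp add: bessel_K0_def bessel_integral_def)

text \<open>Substitute \<open>sqrt 2 * a * s\<close> for \<open>s\<close>, where
  \<open>a = t powr H\<close>: the factor \<open>sqrt 2 * a\<close> is the one that normalises the
  second Gaussian exponent to \<open>- s\<^sup>2\<close>. At \<open>x = 0\<close> both sides are 0,
  the default value of a divergent integral.\<close>

lemma p1_eq_bessel_integral:
  assumes t: "0 < t"
  shows "p1 H x t = bessel_integral 1 (x\<^sup>2 / (t powr H)\<^sup>2) / (pi * t powr H)"
proof -
  define a where "a = t powr H"
  have a: "0 < a" using t by (simp add: a_def)
  have a2: "t powr (2 * H) = a\<^sup>2"
    using t by (simp add: a_def powr_realpow[symmetric] powr_powr mult.commute)
  let ?k = "\<lambda>s. indicator {0<..} s * (exp (- x\<^sup>2 / (2 * s\<^sup>2)) / sqrt (2 * pi * s\<^sup>2) *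
      (exp (- s\<^sup>2 / (2 * a\<^sup>2)) / sqrt (2 * pi * a\<^sup>2))) :: real"
  have c: "sqrt 2 * a \<noteq> 0" using a by simp
  have "p1 H x t = 2 * (LINT s|lborel. ?k s)"
    by (simp add: p1_def set_lebesgue_integral_def a2)
  also have "(LINT s|lborel. ?k s) = sqrt 2 * a * (LINT s|lborel. ?k (0 + sqrt 2 * a * s))"
    using lborel_integral_real_affine[OF c, of ?k 0] a by simp
  also have "(LINT s|lborel. ?k (0 + sqrt 2 * a * s)) =
     (LINT s|lborel. (1 / (2 * sqrt 2 * pi * a\<^sup>2)) * (indicator {0<..} s *
        ((1 / s) ^ 1 * exp (- ((x\<^sup>2 / a\<^sup>2) / (4 * s\<^sup>2)) - s\<^sup>2))))"
  proof (rule Bochner_Integration.integral_cong[OF refl])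
    fix s :: real
    show "?k (0 + sqrt 2 * a * s) = (1 / (2 * sqrt 2 * pi * a\<^sup>2)) * (indicator {0<..} s *
        ((1 / s) ^ 1 * exp (- ((x\<^sup>2 / a\<^sup>2) / (4 * s\<^sup>2)) - s\<^sup>2)))"
    proof (cases "0 < s")
      case True
      have e: "exp (- x\<^sup>2 / (2 * (sqrt 2 * a * s)\<^sup>2)) * exp (- (sqrt 2 * a * s)\<^sup>2 / (2 * a\<^sup>2))
          = exp (- ((x\<^sup>2 / a\<^sup>2) / (4 * s\<^sup>2)) - s\<^sup>2)"
        unfolding exp_add[symmetric] using a True by (simp add: power_mult_distrib field_simps)
      \<comment> \<open>The two normalising roots merge into the root of a perfect square.\<close>
      have "sqrt (2 * pi * (sqrt 2 * a * s)\<^sup>2) * sqrt (2 * pi * a\<^sup>2) = sqrt ((2 * sqrt 2 * pi * a\<^sup>2 * s)\<^sup>2)"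
        unfolding real_sqrt_mult[symmetric] by (simp add: power2_eq_square algebra_simps)
      then have d: "sqrt (2 * pi * (sqrt 2 * a * s)\<^sup>2) * sqrt (2 * pi * a\<^sup>2) = 2 * sqrt 2 * pi * a\<^sup>2 * s"
        using a True by simp
      have "0 < sqrt 2 * a * s" using a True by simp
      then show ?thesis
        using True e d by (simp only: indicator_simps greaterThan_iff add_0 times_divide_times_eq) simp
    next
      case False
      then have "sqrt 2 * a * s \<le> 0" using a by (intro mult_nonneg_nonpos) auto
      then show ?thesis using False by simp
    qed
  qed
  also have "\<dots> = 1 / (2 * sqrt 2 * pi * a\<^sup>2) * bessel_integral 1 (x\<^sup>2 / a\<^sup>2)"
    by (simp only: bessel_integral_def set_lebesgue_integral_def real_scaleR_def integral_mult_right_zero)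
  finally show ?thesis using a by (simp add: a_def[symmetric] field_simps power2_eq_square)
qed

section \<open>The partial differential equation\<close>

lemma p1_eq_bessel_K0:
  assumes "0 < t"
  shows "p1 H x t = 1 / (pi * t powr H) * bessel_K0 (\<bar>x\<bar> / t powr H)"
  using assms by (simp add: p1_eq_bessel_integral bessel_K0_eq_bessel_integral power_divide)

lemma DERIV_bessel_integral_chain:
  assumes "(g has_real_derivative D) (at x)" and "0 < g x"
  shows "((\<lambda>x. bessel_integral n (g x)) has_real_derivative - bessel_integral (n + 2) (g x) / 4 * D) (at x)"
  using DERIV_bessel_integral[OF assms(2)] assms(1) by (rule DERIV_chain2)

text \<open>Off the origin this is - sgn(x) K_1(\<bar>x\<bar> / a) / (pi a^2) with a =
  \<open>t powr H\<close>.\<close>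

definition p1_dx :: "real \<Rightarrow> real \<Rightarrow> real \<Rightarrow> real" where
  "p1_dx H x t = - x * bessel_integral 3 (x\<^sup>2 / (t powr H)\<^sup>2) / (2 * pi * (t powr H) ^ 3)"

lemma DERIV_p1_x:
  assumes x: "x \<noteq> 0" and t: "0 < t"
  shows "((\<lambda>\<xi>. p1 H \<xi> t) has_real_derivative p1_dx H x t) (at x)"
proof -
  define a where "a = t powr H"
  have a: "0 < a" using t by (simp add: a_def)
  have pos: "0 < x\<^sup>2 / a\<^sup>2" using x a by simp
  have "((\<lambda>\<xi>. bessel_integral 1 (\<xi>\<^sup>2 / a\<^sup>2) / (pi * a)) has_real_derivative
      - bessel_integral (1 + 2) (x\<^sup>2 / a\<^sup>2) / 4 * (2 * x / a\<^sup>2) / (pi * a)) (at x)"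
    using pos by (intro DERIV_cdivide DERIV_bessel_integral_chain) (use a in \<open>auto intro!: derivative_eq_intros\<close>)
  then show ?thesis
    by (simp add: p1_eq_bessel_integral[OF t] p1_dx_def a_def[symmetric] power2_eq_square power3_eq_cube
        numeral_3_eq_3 mult_ac)
qed

text \<open>Bessel's equation rescaled to the variable \<open>x / t powr H\<close>. Differentiation
  produces index 5, which \<open>bessel_integral_ode\<close> removes, so that all further space
  derivatives are combinations of \<open>p1\<close> and \<open>p1_dx\<close>.\<close>

lemma DERIV_p1_dx:
  assumes x: "x \<noteq> 0" and t: "0 < t"
  shows "((\<lambda>\<xi>. p1_dx H \<xi> t) has_real_derivative p1 H x t / (t powr H)\<^sup>2 - p1_dx H x t / x) (at x)"
proof -
  define a where "a = t powr H"
  have a: "0 < a" using t by (simp add: a_def)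
  define y where "y = x\<^sup>2 / a\<^sup>2"
  have y: "0 < y" using x a by (simp add: y_def)
  have D: "((\<lambda>\<xi>. - \<xi> * bessel_integral 3 (\<xi>\<^sup>2 / a\<^sup>2) / (2 * pi * a ^ 3)) has_real_derivative
      (- x * (- bessel_integral (3 + 2) y / 4 * (2 * x / a\<^sup>2)) + (- 1) * bessel_integral 3 y) / (2 * pi * a ^ 3)) (at x)"
    unfolding y_def
    using y[unfolded y_def]
    by (intro DERIV_cdivide DERIV_mult' DERIV_bessel_integral_chain) (use a in \<open>auto intro!: derivative_eq_intros\<close>)
  have "(- x * (- bessel_integral (3 + 2) y / 4 * (2 * x / a\<^sup>2)) + (- 1) * bessel_integral 3 y) / (2 * pi * a ^ 3)
      = (2 * (y * bessel_integral 5 y / 4) - bessel_integral 3 y) / (2 * pi * a ^ 3)"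
    by (simp add: y_def power2_eq_square)
  also have "\<dots> = bessel_integral 1 y / (pi * a) / a\<^sup>2 - (- x * bessel_integral 3 y / (2 * pi * a ^ 3)) / x"
    unfolding bessel_integral_ode[OF y] using a x by (simp add: field_simps power2_eq_square power3_eq_cube)
  finally show ?thesis
    unfolding p1_eq_bessel_integral[OF t] p1_dx_def a_def[symmetric] y_def[symmetric] by (rule DERIV_cong[OF D])
qed

text \<open>The distribution is self-similar: \<open>t powr H * p1 H x t\<close> depends only on \<open>x / t powr H\<close>,
  which expresses the time derivative by the first space derivative.\<close>

lemma DERIV_p1_t:
  assumes x: "x \<noteq> 0" and t: "0 < t"
  shows "((\<lambda>\<tau>. p1 H x \<tau>) has_real_derivative - (H / t) * (p1 H x t + x * p1_dx H x t)) (at t)"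
proof -
  define a where "a = t powr H"
  have a: "0 < a" using t by (simp add: a_def)
  have d: "((\<lambda>\<tau>. \<tau> powr H) has_real_derivative H * a / t) (at t)"
    using has_real_derivative_powr[OF t, of H] t by (simp add: a_def powr_diff)
  have pos: "0 < x\<^sup>2 / a\<^sup>2" using x a by simp
  have d2: "((\<lambda>\<tau>. x\<^sup>2 / (\<tau> powr H)\<^sup>2) has_real_derivative - 2 * x\<^sup>2 * H / (t * a\<^sup>2)) (at t)"
    by (rule derivative_eq_intros d refl | use t in simp; fail)+
       (use t a in \<open>simp add: a_def[symmetric] power2_eq_square field_simps\<close>)
  have "((\<lambda>\<tau>. bessel_integral 1 (x\<^sup>2 / (\<tau> powr H)\<^sup>2) / (pi * \<tau> powr H)) has_real_derivative
      ((- bessel_integral (1 + 2) (x\<^sup>2 / a\<^sup>2) / 4 * (- 2 * x\<^sup>2 * H / (t * a\<^sup>2))) * (pi * a)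
        - bessel_integral 1 (x\<^sup>2 / a\<^sup>2) * (pi * (H * a / t))) / (pi * a * (pi * a))) (at t)"
    unfolding a_def
    by (intro DERIV_divide DERIV_cmult DERIV_bessel_integral_chain d2[unfolded a_def] d[unfolded a_def]
        pos[unfolded a_def]) (use t in simp)
  then have "((\<lambda>\<tau>. bessel_integral 1 (x\<^sup>2 / (\<tau> powr H)\<^sup>2) / (pi * \<tau> powr H)) has_real_derivative
      - (H / t) * (p1 H x t + x * p1_dx H x t)) (at t)"
    by (rule DERIV_cong)
       (use t a in \<open>simp add: p1_eq_bessel_integral[OF t] p1_dx_def a_def[symmetric] field_simps power2_eq_square power3_eq_cube
        numeral_3_eq_3\<close>)
  \<comment> \<open>The closed form of \<open>p1\<close> is available only at positive times, so the
    derivative is transferred on the open half-line.\<close>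
  then show ?thesis
    by (rule has_field_derivative_transform_within_open[of _ _ _ "{0<..}"])
       (use t in \<open>auto simp: p1_eq_bessel_integral\<close>)
qed

text \<open>Formulas for iterated \<open>deriv\<close> are known only away from 0. The complement of
  the origin is open, so agreement there suffices to differentiate them once more.\<close>

lemma DERIV_cong_punctured:
  fixes f g :: "real \<Rightarrow> real"
  assumes "(f has_real_derivative D) (at x)" and "x \<noteq> 0" and "\<And>z. z \<noteq> 0 \<Longrightarrow> f z = g z"
  shows "(g has_real_derivative D) (at x)"
  using assms(1) by (rule has_field_derivative_transform_within_open[of _ _ _ "- {0}"])
    (use assms in \<open>auto intro: open_Compl\<close>)

text \<open>With \<open>A = (t powr H)\<^sup>2\<close>, Bessel's equation says that x u' has
  derivative x u / A. Hence its second derivative is (u + x u') / A, which self-similarity makes a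
  multiple of the time derivative.\<close>

lemma p1_pde:
  assumes x: "x \<noteq> 0" and t: "0 < t"
  shows "(\<lambda>\<tau>. p1 H x \<tau>) differentiable (at t)
        \<and> (\<forall>k<3. ((deriv ^^ k) (\<lambda>\<xi>. p1 H \<xi> t)) differentiable (at x))
        \<and> (\<forall>k<2. ((deriv ^^ k) (\<lambda>\<xi>. \<xi> * deriv (\<lambda>\<eta>. p1 H \<eta> t) \<xi>)) differentiable (at x))
        \<and> deriv (\<lambda>\<tau>. p1 H x \<tau>) t
            = - H * t powr (2 * H - 1) *
                (2 * (deriv ^^ 2) (\<lambda>\<xi>. p1 H \<xi> t) x + x * (deriv ^^ 3) (\<lambda>\<xi>. p1 H \<xi> t) x)
        \<and> - H * t powr (2 * H - 1) *
                (2 * (deriv ^^ 2) (\<lambda>\<xi>. p1 H \<xi> t) x + x * (deriv ^^ 3) (\<lambda>\<xi>. p1 H \<xi> t) x)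
            = - H * t powr (2 * H - 1) *
                (deriv ^^ 2) (\<lambda>\<xi>. \<xi> * deriv (\<lambda>\<eta>. p1 H \<eta> t) \<xi>) x"
proof -
  define A where "A = (t powr H)\<^sup>2"
  have A: "0 < A" using t by (simp add: A_def)
  define u where "u = (\<lambda>\<xi>. p1 H \<xi> t)"
  define u1 where "u1 = (\<lambda>\<xi>. p1_dx H \<xi> t)"
  \<comment> \<open>\<open>u2\<close> is the second derivative rewritten by Bessel's equation;
    \<open>u3\<close> is its derivative by the quotient rule.\<close>
  define u2 where "u2 = (\<lambda>\<xi>. u \<xi> / A - u1 \<xi> / \<xi>)"
  define u3 where "u3 = (\<lambda>\<xi>. u1 \<xi> / A - (u2 \<xi> * \<xi> - u1 \<xi>) / \<xi>\<^sup>2)"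
  have D0: "(u has_real_derivative u1 z) (at z)" if "z \<noteq> 0" for z
    unfolding u_def u1_def using that t by (rule DERIV_p1_x)
  have D1: "(u1 has_real_derivative u2 z) (at z)" if "z \<noteq> 0" for z
    unfolding u_def u1_def u2_def A_def using that t by (rule DERIV_p1_dx)
  have D2: "(u2 has_real_derivative u3 z) (at z)" if "z \<noteq> 0" for z
    unfolding u2_def[abs_def]
    by (rule derivative_eq_intros D0 D1 refl that | use A in simp; fail)+
       (use that A in \<open>simp add: u3_def u2_def power2_eq_square\<close>)
  have d1: "deriv u z = u1 z" if "z \<noteq> 0" for z using D0[OF that] by (rule DERIV_imp_deriv)
  have E1: "(deriv u has_real_derivative u2 z) (at z)" if "z \<noteq> 0" for z
    using D1[OF that] that by (rule DERIV_cong_punctured) (simp add: d1)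
  have d2: "deriv (deriv u) z = u2 z" if "z \<noteq> 0" for z using E1[OF that] by (rule DERIV_imp_deriv)
  have E2: "(deriv (deriv u) has_real_derivative u3 z) (at z)" if "z \<noteq> 0" for z
    using D2[OF that] that by (rule DERIV_cong_punctured) (simp add: d2)
  have d3: "deriv (deriv (deriv u)) z = u3 z" if "z \<noteq> 0" for z using E2[OF that] by (rule DERIV_imp_deriv)
  define v where "v = (\<lambda>\<xi>. \<xi> * deriv u \<xi>)"
  \<comment> \<open>The product rule gives \<open>u1 z + z * u2 z\<close>, and the term
    \<open>- u1 z / z\<close> in \<open>u2 z\<close> cancels the first summand.\<close>
  have F0: "(v has_real_derivative z * u z / A) (at z)" if "z \<noteq> 0" for z
    unfolding v_def
    by (rule DERIV_cong[OF DERIV_mult[OF DERIV_ident E1[OF that]]])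
       (use that A in \<open>simp add: d1 u2_def field_simps\<close>)
  have f1: "deriv v z = z * u z / A" if "z \<noteq> 0" for z using F0[OF that] by (rule DERIV_imp_deriv)
  have "((\<lambda>z. z * u z / A) has_real_derivative (u z + z * u1 z) / A) (at z)" if "z \<noteq> 0" for z
    by (rule DERIV_cong[OF DERIV_cdivide[OF DERIV_mult[OF DERIV_ident D0[OF that]]]]) (simp add: mult.commute)
  then have F1: "(deriv v has_real_derivative (u z + z * u1 z) / A) (at z)" if "z \<noteq> 0" for z
    by (rule DERIV_cong_punctured) (use that in \<open>simp_all add: f1\<close>)
  have f2: "deriv (deriv v) z = (u z + z * u1 z) / A" if "z \<noteq> 0" for z
    using F1[OF that] by (rule DERIV_imp_deriv)
  have eq: "2 * u2 x + x * u3 x = (u x + x * u1 x) / A"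
    using x A by (simp add: u3_def u2_def field_simps power2_eq_square)
  have Dt: "((\<lambda>\<tau>. p1 H x \<tau>) has_real_derivative - (H / t) * (u x + x * u1 x)) (at t)"
    unfolding u_def u1_def using x t by (rule DERIV_p1_t)
  \<comment> \<open>The factor \<open>A / t\<close> turns the \<open>1 / A\<close> of the space side
    into the \<open>1 / t\<close> of \<open>Dt\<close>.\<close>
  have c: "t powr (2 * H - 1) = A / t"
    using t by (simp add: A_def powr_diff power2_eq_square powr_add[symmetric])
  have diff: "f differentiable (at z)" if "(f has_real_derivative D) (at z)" for f D and z :: real
    using that by (auto simp: real_differentiable_def)
  have k3: "k = 0 \<or> k = 1 \<or> k = 2" if "k < 3" for k :: nat using that by auto
  have k2: "k = 0 \<or> k = 1" if "k < 2" for k :: nat using that by auto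
  have "\<forall>k<3. ((deriv ^^ k) u) differentiable (at x)"
    using D0[OF x] E1[OF x] E2[OF x] by (auto dest!: k3 diff simp: numeral_2_eq_2)
  moreover have "\<forall>k<2. ((deriv ^^ k) v) differentiable (at x)"
    using F0[OF x] F1[OF x] by (auto dest!: k2 diff)
  moreover have "deriv (\<lambda>\<tau>. p1 H x \<tau>) t = - H * t powr (2 * H - 1) * ((u x + x * u1 x) / A)"
    using DERIV_imp_deriv[OF Dt] A by (simp add: c)
  ultimately show ?thesis
    using diff[OF Dt] x unfolding u_def[symmetric] v_def[symmetric]
    by (simp add: numeral_2_eq_2 numeral_3_eq_3 d2 d3 f2 eq[simplified])
qed

section \<open>Products of independent normal variables\<close>

text \<open>Here \<open>b\<close> is the value of the inner process and acts as the standard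
  deviation of the outer one. Integrability near \<open>b = 0\<close> relies on
  \<open>x \<noteq> 0\<close>: then \<open>exp (- x\<^sup>2 / (2 * b\<^sup>2))\<close> compensates
  the factor 1 / b.\<close>

lemma p1_normal_mixture:
  assumes x: "x \<noteq> 0" and t: "0 < t"
  shows "has_bochner_integral lborel
    (\<lambda>b. normal_density 0 b x * normal_density 0 (t powr H) b) (p1 H x t)"
proof -
  define a where "a = t powr H"
  have a: "0 < a" using t by (simp add: a_def)
  have a2: "t powr (2 * H) = a\<^sup>2"
    using t by (simp add: a_def powr_realpow[symmetric] powr_powr mult.commute)
  define g where "g b = normal_density 0 b x * normal_density 0 a b" for b
  have [measurable]: "g \<in> borel_measurable borel"
    unfolding g_def[abs_def] normal_density_def by measurable
  have g0: "0 \<le> g b" for b by (simp add: g_def)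
  define C where "C = 1 / sqrt (2 * pi) * (1 + fact 1 / (x\<^sup>2 / 2) ^ 1)"
  have bound: "normal_density 0 b x \<le> C" if "0 < b" for b
  proof -
    have "normal_density 0 b x = 1 / sqrt (2 * pi) * ((1 / b) ^ 1 * exp (- ((x\<^sup>2 / 2) / b\<^sup>2)))"
      using that by (simp add: normal_density_def real_sqrt_mult)
    also have "\<dots> \<le> C"
      unfolding C_def using x that
      by (intro mult_left_mono inverse_power_times_exp_bounded) auto
    finally show ?thesis .
  qed
  have "integrable lborel (\<lambda>b. indicator {0..} b *\<^sub>R g b)"
  proof (rule Bochner_Integration.integrable_bound)
    show "integrable lborel (\<lambda>b. C * normal_density 0 a b)"
      using a by (intro integrable_mult_right integrable_normal_density)
    show "AE b in lborel. norm (indicator {0..} b *\<^sub>R g b) \<le> norm (C * normal_density 0 a b)"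
    proof (rule AE_I2)
      fix b :: real
      have "0 \<le> C" by (simp add: C_def)
      moreover have "g b \<le> C * normal_density 0 a b" if "0 < b"
        unfolding g_def by (intro mult_right_mono bound that) simp
      moreover have "g 0 = 0" by (simp add: g_def normal_density_def)
      ultimately show "norm (indicator {0..} b *\<^sub>R g b) \<le> norm (C * normal_density 0 a b)"
        using g0[of b] by (cases b "0 :: real" rule: linorder_cases) (auto simp: indicator_def abs_mult)
    qed
  qed measurable
  \<comment> \<open>The formula of \<open>normal_density\<close> sees \<open>b\<close> only through
    its square, so it is meaningful for negative \<open>b\<close> and \<open>g\<close> is even; this
    is the origin of the factor 2 in \<open>p1\<close>.\<close>
  then have "has_bochner_integral lborel g (2 *\<^sub>R (LBINT b. indicator {0..} b *\<^sub>R g b))"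
    by (intro has_bochner_integral_even_function has_bochner_integral_integrable)
       (simp_all add: g_def normal_density_def)
  also have "(LBINT b. indicator {0..} b *\<^sub>R g b) = (LBINT b. indicator {0<..} b *\<^sub>R g b)"
    by (intro Bochner_Integration.integral_cong refl)
       (auto simp: indicator_def g_def normal_density_def)
  also have "2 *\<^sub>R (LBINT b. indicator {0<..} b *\<^sub>R g b) = p1 H x t"
    by (simp add: p1_def set_lebesgue_integral_def g_def normal_density_def a2)
  finally show ?thesis by (simp add: g_def[abs_def] a_def)
qed

lemma borel_measurable_p1 [measurable]: "(\<lambda>x. p1 H x t) \<in> borel_measurable borel"
  unfolding p1_def set_lebesgue_integral_def by measurable

text \<open>For fixed \<open>b\<close> the substitution \<open>x = b * z\<close> turns the standard
  normal density into \<open>normal_density 0 b\<close>; Tonelli's theorem then leaves the mixture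
  over \<open>b\<close>, which is \<open>p1\<close>.\<close>

lemma distr_normal_product:
  assumes t: "0 < t"
  shows "distr (density lborel (\<lambda>b. ennreal (normal_density 0 (t powr H) b)) \<Otimes>\<^sub>M std_normal_distribution) borel
      (\<lambda>(b, z). b * z) = density lborel (\<lambda>x. ennreal (p1 H x t))"
    (is "distr (?N \<Otimes>\<^sub>M ?Z) borel _ = _")
proof (rule measure_eqI)
  fix A assume "A \<in> sets (distr (?N \<Otimes>\<^sub>M ?Z) borel (\<lambda>(b, z). b * z))"
  then have A [measurable]: "A \<in> sets borel" by simp
  interpret Z: prob_space ?Z by (rule prob_space_normal_density) simp
  let ?n = "\<lambda>b. normal_density 0 (t powr H) b"
  have meas [measurable]: "(\<lambda>(b, x). normal_density 0 b x) \<in> borel_measurable (borel \<Otimes>\<^sub>M borel)"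
    unfolding normal_density_def by measurable
  have "emeasure (distr (?N \<Otimes>\<^sub>M ?Z) borel (\<lambda>(b, z). b * z)) A
      = (\<integral>\<^sup>+p. indicator A (case p of (b, z) \<Rightarrow> b * z) \<partial>(?N \<Otimes>\<^sub>M ?Z))"
    by (subst nn_integral_indicator[symmetric], simp, subst nn_integral_distr) auto
  also have "\<dots> = (\<integral>\<^sup>+b. \<integral>\<^sup>+z. indicator A (b * z) \<partial>?Z \<partial>?N)"
    by (subst Z.nn_integral_fst[symmetric]) auto
  also have "\<dots> = (\<integral>\<^sup>+b. ennreal (?n b) * (\<integral>\<^sup>+z. ennreal (std_normal_density z) * indicator A (b * z) \<partial>lborel) \<partial>lborel)"
    by (simp add: nn_integral_density)
  also have "\<dots> = (\<integral>\<^sup>+b. ennreal (?n b) * (\<integral>\<^sup>+x. ennreal (normal_density 0 b x) * indicator A x \<partial>lborel) \<partial>lborel)"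
  proof (rule nn_integral_cong_AE)
    show "AE b in lborel. ennreal (?n b) * (\<integral>\<^sup>+z. ennreal (std_normal_density z) * indicator A (b * z) \<partial>lborel)
        = ennreal (?n b) * (\<integral>\<^sup>+x. ennreal (normal_density 0 b x) * indicator A x \<partial>lborel)"
      \<comment> \<open>The substitution degenerates at \<open>b = 0\<close>, a null set; elsewhere
        its Jacobian is \<open>\<bar>b\<bar>\<close>.\<close>
      using AE_lborel_singleton[of 0]
    proof eventually_elim
      case (elim b)
      have "(\<integral>\<^sup>+x. ennreal (normal_density 0 b x) * indicator A x \<partial>lborel)
          = ennreal \<bar>b\<bar> * (\<integral>\<^sup>+z. ennreal (normal_density 0 b (0 + b * z)) * indicator A (0 + b * z) \<partial>lborel)"
        using elim by (intro nn_integral_real_affine) auto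
      also have "\<dots> = (\<integral>\<^sup>+z. ennreal (std_normal_density z) * indicator A (b * z) \<partial>lborel)"
      proof (subst nn_integral_cmult[symmetric])
        have "\<bar>b\<bar> * normal_density 0 b (b * z) = std_normal_density z" for z
          using elim by (simp add: normal_density_def real_sqrt_mult power_mult_distrib)
        then have "ennreal \<bar>b\<bar> * ennreal (normal_density 0 b (b * z)) = ennreal (std_normal_density z)" for z
          by (metis abs_ge_zero ennreal_mult' )
        then show "(\<integral>\<^sup>+z. ennreal \<bar>b\<bar> * (ennreal (normal_density 0 b (0 + b * z)) * indicator A (0 + b * z)) \<partial>lborel)
            = (\<integral>\<^sup>+z. ennreal (std_normal_density z) * indicator A (b * z) \<partial>lborel)"
          by (simp add: mult.assoc[symmetric])
      qed auto
      finally show ?case by simp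
    qed
  qed
  also have "\<dots> = (\<integral>\<^sup>+b. \<integral>\<^sup>+x. ennreal (?n b) * (ennreal (normal_density 0 b x) * indicator A x) \<partial>lborel \<partial>lborel)"
    by (subst nn_integral_cmult) auto
  also have "\<dots> = (\<integral>\<^sup>+x. \<integral>\<^sup>+b. ennreal (?n b) * (ennreal (normal_density 0 b x) * indicator A x) \<partial>lborel \<partial>lborel)"
    by (rule lborel_pair.Fubini'[symmetric]) measurable
  also have "\<dots> = (\<integral>\<^sup>+x. ennreal (p1 H x t) * indicator A x \<partial>lborel)"
  proof (rule nn_integral_cong_AE)
    show "AE x in lborel. (\<integral>\<^sup>+b. ennreal (?n b) * (ennreal (normal_density 0 b x) * indicator A x) \<partial>lborel)
        = ennreal (p1 H x t) * indicator A x"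
      \<comment> \<open>The mixture formula excludes \<open>x = 0\<close>, again a null set.\<close>
      using AE_lborel_singleton[of 0]
    proof eventually_elim
      case (elim x)
      have "(\<integral>\<^sup>+b. ennreal (?n b) * (ennreal (normal_density 0 b x) * indicator A x) \<partial>lborel)
          = (\<integral>\<^sup>+b. ennreal (normal_density 0 b x * ?n b) * indicator A x \<partial>lborel)"
        by (simp add: ennreal_mult' mult_ac)
      also have "\<dots> = (\<integral>\<^sup>+b. ennreal (normal_density 0 b x * ?n b) \<partial>lborel) * indicator A x"
        by (rule nn_integral_multc) measurable
      also have "(\<integral>\<^sup>+b. ennreal (normal_density 0 b x * ?n b) \<partial>lborel) = ennreal (p1 H x t)"
        using p1_normal_mixture[OF elim t, of H]
        by (subst nn_integral_eq_integral) (auto simp: has_bochner_integral_iff)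
      finally show ?case .
    qed
  qed
  also have "\<dots> = emeasure (density lborel (\<lambda>x. ennreal (p1 H x t))) A"
    by (simp add: emeasure_density)
  finally show "emeasure (distr (?N \<Otimes>\<^sub>M ?Z) borel (\<lambda>(b, z). b * z)) A
      = emeasure (density lborel (\<lambda>x. ennreal (p1 H x t))) A" .
qed simp

text \<open>Integrating over the normal factor first gives its characteristic function at
  \<open>u * b\<close>.\<close>

lemma char_normal_product:
  assumes N: "prob_space N" and [measurable_cong]: "sets N = sets borel"
  shows "char (distr (N \<Otimes>\<^sub>M std_normal_distribution) borel (\<lambda>(b, z). b * z)) u
    = (CLINT b|N. complex_of_real (exp (- (u * b)\<^sup>2 / 2)))"
proof -
  let ?Z = std_normal_distribution
  interpret N: prob_space N by fact
  interpret Z: prob_space ?Z by (rule prob_space_normal_density) simp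
  interpret pair_prob_space N ?Z ..
  have "char (distr (N \<Otimes>\<^sub>M ?Z) borel (\<lambda>(b, z). b * z)) u
      = (CLINT p|N \<Otimes>\<^sub>M ?Z. case p of (b, z) \<Rightarrow> iexp (u * b * z))"
    unfolding char_def by (subst integral_distr) (auto simp: case_prod_unfold mult.assoc)
  also have "\<dots> = (CLINT b|N. CLINT z|?Z. iexp (u * b * z))"
    by (subst integral_fst) (auto intro!: integrable_const_bound[where B = 1] simp: case_prod_unfold)
  also have "\<dots> = (CLINT b|N. char ?Z (u * b))"
    by (simp add: char_def)
  finally show ?thesis by (simp add: char_std_normal_distribution)
qed

section \<open>Centred Gaussian variables\<close>

context prob_space
begin

text \<open>The first two moments recover the existentially quantified parameters: the mean forces
  \<open>\<mu> = 0\<close>, and the second moment is 0 or \<open>\<sigma>\<^sup>2\<close> according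
  to the case.\<close>

lemma gaussian_rv_centered_cases:
  assumes X: "gaussian_rv M X" and mean: "(LINT \<omega>|M. X \<omega>) = 0"
    and var: "(LINT \<omega>|M. X \<omega> * X \<omega>) = v"
  obtains (degenerate) "v = 0" "AE \<omega> in M. X \<omega> = 0"
    | (normal) "0 < v" "distributed M lborel X (\<lambda>x. ennreal (normal_density 0 (sqrt v) x))"
proof -
  from X obtain \<mu> where [measurable]: "X \<in> borel_measurable M"
    and \<mu>: "(AE \<omega> in M. X \<omega> = \<mu>) \<or> (\<exists>\<sigma>>0. distributed M lborel X (\<lambda>x. ennreal (normal_density \<mu> \<sigma> x)))"
    unfolding gaussian_rv_def by blast
  from \<mu> show thesis
  proof (elim disjE exE conjE)
    assume AE: "AE \<omega> in M. X \<omega> = \<mu>"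
    then have "(LINT \<omega>|M. X \<omega>) = (LINT \<omega>|M. \<mu>)" by (intro integral_cong_AE) auto
    then have \<mu>0: "\<mu> = 0" using mean prob_space by simp
    with AE have "(LINT \<omega>|M. X \<omega> * X \<omega>) = (LINT \<omega>|M. 0)" by (intro integral_cong_AE) auto
    then show thesis using degenerate AE \<mu>0 var by simp
  next
    fix \<sigma> :: real assume \<sigma>: "0 < \<sigma>" and D: "distributed M lborel X (\<lambda>x. ennreal (normal_density \<mu> \<sigma> x))"
    have \<mu>0: "\<mu> = 0" using normal_distributed_expectation[OF \<sigma> D] mean by simp
    have v: "v = \<sigma>\<^sup>2" using normal_distributed_variance[OF \<sigma> D] mean var by (simp add: power2_eq_square)
    show thesis by (rule normal) (use D \<mu>0 \<sigma> v in simp_all)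
  qed
qed

text \<open>Standardising handles positive variance. The same formula gives 1 for
  \<open>v = 0\<close>, so time 0 of the process needs no separate treatment later.\<close>

lemma char_gaussian_rv_centered:
  assumes X: "gaussian_rv M X" and mean: "(LINT \<omega>|M. X \<omega>) = 0"
    and var: "(LINT \<omega>|M. X \<omega> * X \<omega>) = v"
  shows "(CLINT \<omega>|M. iexp (u * X \<omega>)) = complex_of_real (exp (- u\<^sup>2 * v / 2))"
proof -
  have [measurable]: "X \<in> borel_measurable M" using X by (simp add: gaussian_rv_def)
  from X mean var show ?thesis
  proof (cases rule: gaussian_rv_centered_cases)
    case degenerate
    have "(CLINT \<omega>|M. iexp (u * X \<omega>)) = (CLINT \<omega>|M. 1)"
      using degenerate(2) by (intro integral_cong_AE) auto
    then show ?thesis using degenerate(1) prob_space by simp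
  next
    case normal
    define \<sigma> where "\<sigma> = sqrt v"
    have \<sigma>: "0 < \<sigma>" using normal by (simp add: \<sigma>_def)
    have "distributed M lborel (\<lambda>\<omega>. (X \<omega> - 0) / \<sigma>) (\<lambda>x. ennreal (std_normal_density x))"
      using normal(2) normal_standard_normal_convert[OF \<sigma>, of X 0] by (simp add: \<sigma>_def)
    then have D: "distr M lborel (\<lambda>\<omega>. X \<omega> / \<sigma>) = std_normal_distribution"
      by (simp add: distributed_def)
    have "(CLINT \<omega>|M. iexp (u * X \<omega>)) = (CLINT \<omega>|M. iexp ((u * \<sigma>) * (X \<omega> / \<sigma>)))"
      using \<sigma> by simp
    also have "\<dots> = char (distr M lborel (\<lambda>\<omega>. X \<omega> / \<sigma>)) (u * \<sigma>)"
      unfolding char_def by (subst integral_distr) auto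
    finally show ?thesis
      using normal(1) unfolding D char_std_normal_distribution by (simp add: \<sigma>_def power_mult_distrib)
  qed
qed

end

section \<open>Evaluating a process at an independent random time\<close>

text \<open>Evaluation of a path at a random time need not be measurable on the product space, so the
  random time \<open>S\<close> is approximated from below by the grid times \<open>\<lfloor>(n + 1) S\<rfloor> / (n + 1)\<close>, which
  take countably many values.\<close>

definition grid_time :: "nat \<Rightarrow> real \<Rightarrow> real" where
  "grid_time n s = real (nat \<lfloor>real (Suc n) * s\<rfloor>) / real (Suc n)"

lemma grid_time_nonneg: "0 \<le> grid_time n s"
  by (simp add: grid_time_def)

lemma grid_time_tendsto:
  assumes s: "0 \<le> s"
  shows "(\<lambda>n. grid_time n s) \<longlonglongrightarrow> s"
proof (rule tendsto_sandwich)
  have *: "real (nat \<lfloor>real (Suc n) * s\<rfloor>) = of_int \<lfloor>real (Suc n) * s\<rfloor>" for n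
    using s by (subst of_nat_nat) auto
  show "\<forall>\<^sub>F n in sequentially. s - 1 / real (Suc n) \<le> grid_time n s"
  proof (intro always_eventually allI)
    fix n
    have "real (Suc n) * s - 1 \<le> of_int \<lfloor>real (Suc n) * s\<rfloor>" by linarith
    then have "(real (Suc n) * s - 1) / real (Suc n) \<le> grid_time n s"
      unfolding grid_time_def * by (intro divide_right_mono) auto
    then show "s - 1 / real (Suc n) \<le> grid_time n s" by (simp add: diff_divide_distrib)
  qed
  show "\<forall>\<^sub>F n in sequentially. grid_time n s \<le> s"
    using s by (intro always_eventually allI)
      (simp add: grid_time_def divide_le_eq mult.commute of_nat_nat del: of_nat_Suc)
  show "(\<lambda>n. s - 1 / real (Suc n)) \<longlonglongrightarrow> s"
    using tendsto_diff[OF tendsto_const[of s] LIMSEQ_inverse_real_of_nat] by (simp add: inverse_eq_divide)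
qed simp

context prob_space
begin

text \<open>Factoring \<open>S\<close> through \<open>Y\<close> lets the path and the clock be
  integrated separately under their product law.\<close>

context
  fixes T :: "real set" and X :: "real \<Rightarrow> 'a \<Rightarrow> real" and S :: "'a \<Rightarrow> real"
    and N :: "(real \<Rightarrow> real) measure" and Y :: "'a \<Rightarrow> real \<Rightarrow> real" and f :: "(real \<Rightarrow> real) \<Rightarrow> real"
  assumes T: "{0..} \<subseteq> T"
    and cont: "\<And>\<omega>. \<omega> \<in> space M \<Longrightarrow> continuous_on T (\<lambda>t. X t \<omega>)"
    and S: "\<And>\<omega>. 0 \<le> S \<omega>"
    and indep: "indep_var (PiM T (\<lambda>_. borel)) (\<lambda>\<omega>. \<lambda>t\<in>T. X t \<omega>) N Y"
    and f: "f \<in> borel_measurable N"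
    and S_eq: "\<And>\<omega>. \<omega> \<in> space M \<Longrightarrow> S \<omega> = f (Y \<omega>)"
begin

lemma random_time_measurable [measurable]: "S \<in> borel_measurable M"
  using measurable_compose[OF indep_var_rv2[OF indep] f] S_eq by (simp cong: measurable_cong)

lemma process_measurable: "t \<in> T \<Longrightarrow> X t \<in> borel_measurable M"
  using measurable_compose[OF indep_var_rv1[OF indep] measurable_component_singleton[of t T "\<lambda>_. borel"]]
  by simp

lemma grid_time_in: "grid_time n s \<in> T"
  using T grid_time_nonneg by auto

lemma process_at_grid_time_measurable [measurable]:
  "(\<lambda>\<omega>. X (grid_time n (S \<omega>)) \<omega>) \<in> borel_measurable M"
  unfolding grid_time_def
proof (rule measurable_compose_countable[where f = "\<lambda>k \<omega>. X (real k / real (Suc n)) \<omega>"])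
  show "X (real k / real (Suc n)) \<in> borel_measurable M" for k
    using T by (intro process_measurable) auto
qed measurable

lemma process_at_grid_time_tendsto:
  assumes "\<omega> \<in> space M"
  shows "(\<lambda>n. X (grid_time n (S \<omega>)) \<omega>) \<longlonglongrightarrow> X (S \<omega>) \<omega>"
  using continuous_on_tendsto_compose[OF cont[OF assms] grid_time_tendsto[OF S]] T S[of \<omega>] grid_time_in
  by auto

lemma process_at_random_time_measurable: "(\<lambda>\<omega>. X (S \<omega>) \<omega>) \<in> borel_measurable M"
  using process_at_grid_time_tendsto by (rule borel_measurable_LIMSEQ_real) measurable

text \<open>By independence the joint law of path and \<open>Y\<close> is a product. Once
  \<open>y\<close> is fixed, the grid time \<open>\<tau> y\<close> is deterministic, so integrating
  out the path yields \<open>\<phi> (\<tau> y)\<close>.\<close>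

lemma iexp_process_at_grid_time:
  assumes \<phi>: "\<And>s. 0 \<le> s \<Longrightarrow> (CLINT \<omega>|M. iexp (u * X s \<omega>)) = \<phi> s"
  shows "(CLINT \<omega>|M. iexp (u * X (grid_time n (S \<omega>)) \<omega>)) = (CLINT \<omega>|M. \<phi> (grid_time n (S \<omega>)))"
proof -
  define P where "P = PiM T (\<lambda>_. borel :: real measure)"
  define X' where "X' \<omega> = (\<lambda>t\<in>T. X t \<omega>)" for \<omega>
  define \<tau> where "\<tau> y = grid_time n (f y)" for y
  define h where "h x y = iexp (u * x (\<tau> y))" for x y :: "real \<Rightarrow> real"
  have \<tau>: "\<tau> y \<in> T" "0 \<le> \<tau> y" for y
    by (simp_all add: \<tau>_def grid_time_in grid_time_nonneg)
  note f [measurable]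
  have [measurable]: "X' \<in> measurable M P" "Y \<in> measurable M N"
    using indep_var_rv1[OF indep] indep_var_rv2[OF indep] by (simp_all add: P_def X'_def[abs_def])
  have prod: "distr M P X' \<Otimes>\<^sub>M distr M N Y = distr M (P \<Otimes>\<^sub>M N) (\<lambda>\<omega>. (X' \<omega>, Y \<omega>))"
    using indep unfolding indep_var_distribution_eq by (simp add: P_def X'_def[abs_def])
  have comp [measurable]: "s \<in> T \<Longrightarrow> (\<lambda>x. x s) \<in> borel_measurable P" for s
    unfolding P_def by (rule measurable_component_singleton)
  \<comment> \<open>Evaluation at \<open>\<tau> y\<close> is jointly measurable because only
    countably many coordinates can be selected.\<close>
  have h_meas [measurable]: "case_prod h \<in> borel_measurable (P \<Otimes>\<^sub>M N)"
    unfolding case_prod_unfold h_def \<tau>_def grid_time_def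
  proof (rule measurable_compose_countable[where
        f = "\<lambda>k p. iexp (u * fst p (real k / real (Suc n)))" and g = "\<lambda>p. nat \<lfloor>real (Suc n) * f (snd p)\<rfloor>"])
    show "(\<lambda>p. iexp (u * fst p (real k / real (Suc n)))) \<in> borel_measurable (P \<Otimes>\<^sub>M N)" for k
    proof -
      have "(\<lambda>p. fst p (real k / real (Suc n))) \<in> borel_measurable (P \<Otimes>\<^sub>M N)"
        using T by (intro measurable_compose[OF measurable_fst comp]) auto
      then show ?thesis by measurable
    qed
  qed measurable
  interpret DX: prob_space "distr M P X'" by (rule prob_space_distr) measurable
  interpret DY: prob_space "distr M N Y" by (rule prob_space_distr) measurable
  interpret D: pair_prob_space "distr M P X'" "distr M N Y" ..
  have inner: "(CLINT x|distr M P X'. h x y) = \<phi> (\<tau> y)" for y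
  proof -
    have "(\<lambda>x. h x y) \<in> borel_measurable P"
      unfolding h_def using comp[OF \<tau>(1), of y] by measurable
    then have "(CLINT x|distr M P X'. h x y) = (CLINT \<omega>|M. h (X' \<omega>) y)"
      by (rule integral_distr[OF \<open>X' \<in> measurable M P\<close>])
    also have "\<dots> = \<phi> (\<tau> y)"
      unfolding \<phi>[OF \<tau>(2), symmetric] by (simp only: h_def X'_def restrict_apply'[OF \<tau>(1)])
    finally show ?thesis .
  qed
  have int: "integrable (distr M P X' \<Otimes>\<^sub>M distr M N Y) (case_prod h)"
    by (rule D.integrable_const_bound[where B = 1]) (auto simp: h_def)
  have "(CLINT \<omega>|M. iexp (u * X (grid_time n (S \<omega>)) \<omega>)) = (CLINT \<omega>|M. h (X' \<omega>) (Y \<omega>))"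
    using \<tau> by (intro Bochner_Integration.integral_cong) (auto simp: \<tau>_def S_eq h_def X'_def grid_time_in)
  also have "\<dots> = (CLINT p|distr M (P \<Otimes>\<^sub>M N) (\<lambda>\<omega>. (X' \<omega>, Y \<omega>)). case_prod h p)"
    by (subst integral_distr) auto
  also have "\<dots> = (CLINT y|distr M N Y. CLINT x|distr M P X'. h x y)"
    unfolding prod[symmetric] by (rule D.integral_snd[OF int, symmetric])
  also have "\<dots> = (CLINT \<omega>|M. \<phi> (\<tau> (Y \<omega>)))"
  proof -
    have "(\<lambda>y. CLINT x|distr M P X'. h x y) \<in> borel_measurable (distr M N Y)"
      using D.integrable_snd[OF int] by (rule borel_measurable_integrable)
    then show ?thesis unfolding inner by (intro integral_distr) auto
  qed
  also have "\<dots> = (CLINT \<omega>|M. \<phi> (grid_time n (S \<omega>)))"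
    by (intro Bochner_Integration.integral_cong) (auto simp: \<tau>_def S_eq)
  finally show ?thesis .
qed

text \<open>Refine the grid: both sides of the grid identity converge by dominated convergence with
  bound 1, the left by continuity of paths and the right by continuity of
  \<open>\<phi>\<close>.\<close>

lemma iexp_process_at_random_time:
  assumes \<phi>: "\<And>s. 0 \<le> s \<Longrightarrow> (CLINT \<omega>|M. iexp (u * X s \<omega>)) = \<phi> s"
    and \<phi>_cont: "continuous_on {0..} \<phi>"
  shows "(CLINT \<omega>|M. iexp (u * X (S \<omega>) \<omega>)) = (CLINT \<omega>|M. \<phi> (S \<omega>))"
proof (rule LIMSEQ_unique)
  show "(\<lambda>n. CLINT \<omega>|M. iexp (u * X (grid_time n (S \<omega>)) \<omega>)) \<longlonglongrightarrow> (CLINT \<omega>|M. iexp (u * X (S \<omega>) \<omega>))"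
  proof (rule integral_dominated_convergence[where w = "\<lambda>_. 1"])
    show "AE \<omega> in M. (\<lambda>n. iexp (u * X (grid_time n (S \<omega>)) \<omega>)) \<longlonglongrightarrow> iexp (u * X (S \<omega>) \<omega>)"
      by (intro AE_I2 tendsto_intros process_at_grid_time_tendsto)
  qed (use process_at_random_time_measurable in auto)
  \<comment> \<open>Continuity of \<open>\<phi>\<close> is assumed on \<open>{0..}\<close> only, so
    it is extended by 0 to a Borel function on the whole line.\<close>
  have \<phi>_meas: "(\<lambda>\<omega>. \<phi> (S' \<omega>)) \<in> borel_measurable M"
    if [measurable]: "S' \<in> borel_measurable M" and "\<And>\<omega>. 0 \<le> S' \<omega>" for S'
  proof -
    have "(\<lambda>s. indicator {0..} s *\<^sub>R \<phi> s) \<in> borel_measurable borel"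
      by (intro borel_measurable_continuous_on_indicator \<phi>_cont) auto
    from measurable_compose[OF that(1) this] show ?thesis using that(2) by simp
  qed
  have "(\<lambda>n. CLINT \<omega>|M. \<phi> (grid_time n (S \<omega>))) \<longlonglongrightarrow> (CLINT \<omega>|M. \<phi> (S \<omega>))"
  proof (rule integral_dominated_convergence[where w = "\<lambda>_. 1"])
    show "(\<lambda>\<omega>. \<phi> (S \<omega>)) \<in> borel_measurable M" by (rule \<phi>_meas) (auto intro: S)
    show "(\<lambda>\<omega>. \<phi> (grid_time n (S \<omega>))) \<in> borel_measurable M" for n
      by (rule \<phi>_meas) (auto simp: grid_time_def)
    show "AE \<omega> in M. (\<lambda>n. \<phi> (grid_time n (S \<omega>))) \<longlonglongrightarrow> \<phi> (S \<omega>)"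
      using S by (intro AE_I2 continuous_on_tendsto_compose[OF \<phi>_cont grid_time_tendsto])
        (auto simp: grid_time_nonneg)
    \<comment> \<open>A value of \<open>\<phi>\<close> at a nonnegative time is an expectation of
      unit complex numbers.\<close>
    show "AE \<omega> in M. norm (\<phi> (grid_time n (S \<omega>))) \<le> 1" for n
    proof (rule AE_I2)
      fix \<omega>
      let ?g = "grid_time n (S \<omega>)"
      have "norm (CLINT \<omega>'|M. iexp (u * X ?g \<omega>')) \<le> (LINT \<omega>'|M. norm (iexp (u * X ?g \<omega>')))"
        by (rule integral_norm_bound)
      then show "norm (\<phi> ?g) \<le> 1"
        unfolding \<phi>[OF grid_time_nonneg] by (simp add: prob_space)
    qed
  qed simp
  then show "(\<lambda>n. CLINT \<omega>|M. iexp (u * X (grid_time n (S \<omega>)) \<omega>)) \<longlonglongrightarrow> (CLINT \<omega>|M. \<phi> (S \<omega>))"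
    by (simp only: iexp_process_at_grid_time[of u \<phi>, OF \<phi>])
qed

end

end

section \<open>Iterated fractional Brownian motion\<close>

lemma distributed_iterated_fbm:
  fixes M :: "'a measure"
  assumes "prob_space M" and H: "0 < H" and T: "{0..} \<subseteq> T"
    and B1: "fractional_brownian_motion M H T B1"
    and B2: "fractional_brownian_motion M H T B2"
    and ind: "independent_processes M T B1 B2"
    and cont: "\<And>\<omega>. \<omega> \<in> space M \<Longrightarrow> continuous_on T (\<lambda>t. B1 t \<omega>)"
    and t: "0 < t"
  shows "distributed M lborel (iterated_fbm H B1 B2 t) (\<lambda>x. ennreal (p1 H x t))"
proof -
  interpret prob_space M by fact
  let ?J = "iterated_fbm H B1 B2 t"
  have gauss: "gaussian_rv M (B s)" if "fractional_brownian_motion M H T B" "s \<in> T" for B s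
  proof -
    have "gaussian_process M T B" using that(1) by (simp add: fractional_brownian_motion_def)
    from this[unfolded gaussian_process_def, rule_format, of "{s}" "\<lambda>_. 1"] that(2)
    show ?thesis by simp
  qed
  have mean: "(LINT \<omega>|M. B s \<omega>) = 0" if "fractional_brownian_motion M H T B" "s \<in> T" for B s
    using that by (simp add: fractional_brownian_motion_def)
  have var: "(LINT \<omega>|M. B s \<omega> * B s \<omega>) = s powr (2 * H)"
    if "fractional_brownian_motion M H T B" "s \<in> T" "0 \<le> s" for B s
  proof -
    have "\<forall>r\<in>T. \<forall>t\<in>T. (LINT \<omega>|M. B r \<omega> * B t \<omega>)
        = (\<bar>t\<bar> powr (2 * H) + \<bar>r\<bar> powr (2 * H) - \<bar>t - r\<bar> powr (2 * H)) / 2"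
      using that(1) unfolding fractional_brownian_motion_def by blast
    from bspec[OF bspec[OF this that(2)] that(2)] show ?thesis using that(3) by simp
  qed
  have tT: "t \<in> T" using t T by auto
  define \<sigma> where "\<sigma> = t powr H"
  have \<sigma>: "0 < \<sigma>" using t by (simp add: \<sigma>_def)
  have "t powr (2 * H) = \<sigma>\<^sup>2"
    using t by (simp add: \<sigma>_def powr_realpow[symmetric] powr_powr mult.commute)
  then have "sqrt (t powr (2 * H)) = \<sigma>" using \<sigma> by simp
  \<comment> \<open>The variance at \<open>t > 0\<close> is positive, which rules out the degenerate
    case.\<close>
  then have B2_normal: "distributed M lborel (B2 t) (\<lambda>x. ennreal (normal_density 0 \<sigma> x))"
    using t by (cases rule: gaussian_rv_centered_cases[OF gauss[OF B2 tT] mean[OF B2 tT] var[OF B2 tT]]) auto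
  let ?N = "density lborel (\<lambda>b. ennreal (normal_density 0 \<sigma> b))"
  have B2_distr: "distr M lborel (B2 t) = ?N"
    using B2_normal by (simp add: distributed_def)
  have B2_meas [measurable]: "B2 t \<in> borel_measurable M"
    using B2_normal by (simp add: distributed_def)
  define S where "S \<omega> = \<bar>B2 t \<omega>\<bar> powr (1 / H)" for \<omega>
  have indB: "indep_var (PiM T (\<lambda>_. borel)) (\<lambda>\<omega>. \<lambda>t\<in>T. B1 t \<omega>)
      (PiM T (\<lambda>_. borel)) (\<lambda>\<omega>. \<lambda>t\<in>T. B2 t \<omega>)"
    using ind by (simp add: independent_processes_def)
  have f: "(\<lambda>y. \<bar>y t\<bar> powr (1 / H)) \<in> borel_measurable (PiM T (\<lambda>_. borel :: real measure))"
  proof -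
    have [measurable]: "(\<lambda>y. y t) \<in> borel_measurable (PiM T (\<lambda>_. borel :: real measure))"
      using tT by (rule measurable_component_singleton)
    show ?thesis by measurable
  qed
  have S_eq: "S \<omega> = \<bar>(\<lambda>t\<in>T. B2 t \<omega>) t\<bar> powr (1 / H)" if "\<omega> \<in> space M" for \<omega>
    using tT by (simp add: S_def)
  have S: "0 \<le> S \<omega>" for \<omega> by (simp add: S_def)
  let ?f = "\<lambda>y. \<bar>y t\<bar> powr (1 / H) :: real"
  let ?Y = "\<lambda>\<omega>. \<lambda>t\<in>T. B2 t \<omega>"
  note random_time = T cont S indB f S_eq
  have J: "?J = (\<lambda>\<omega>. B1 (S \<omega>) \<omega>)" by (simp add: iterated_fbm_def S_def fun_eq_iff)
  have J_meas [measurable]: "?J \<in> borel_measurable M"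
    unfolding J
    by (rule process_at_random_time_measurable[where X = B1 and S = S and f = ?f and Y = ?Y]) (fact random_time)+
  have "char (distr M borel ?J) u
      = char (distr (?N \<Otimes>\<^sub>M std_normal_distribution) borel (\<lambda>(b, z). b * z)) u" for u
  proof -
    let ?\<phi> = "\<lambda>s. complex_of_real (exp (- u\<^sup>2 * s powr (2 * H) / 2))"
    have "char (distr M borel ?J) u = (CLINT \<omega>|M. iexp (u * B1 (S \<omega>) \<omega>))"
    proof -
      have "char (distr M borel ?J) u = (CLINT \<omega>|M. iexp (u * ?J \<omega>))"
        unfolding char_def by (rule integral_distr) measurable
      then show ?thesis by (simp only: J)
    qed
    also have "\<dots> = (CLINT \<omega>|M. ?\<phi> (S \<omega>))"
    proof (rule iexp_process_at_random_time[where X = B1 and S = S and f = ?f and Y = ?Y])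
      fix s :: real assume s: "0 \<le> s"
      then have sT: "s \<in> T" using T by auto
      show "(CLINT \<omega>|M. iexp (u * B1 s \<omega>)) = ?\<phi> s"
        by (rule char_gaussian_rv_centered[OF gauss[OF B1 sT] mean[OF B1 sT] var[OF B1 sT s]])
    next
      \<comment> \<open>Continuity at 0 depends on the exponent \<open>2 * H\<close> being
        positive.\<close>
      show "continuous_on {0..} ?\<phi>"
      proof -
        have "continuous_on {0..} (\<lambda>s :: real. s powr (2 * H))"
          using H by (intro continuous_on_powr') auto
        then show ?thesis
          by (intro continuous_on_of_real continuous_on_exp continuous_on_divide continuous_on_mult
              continuous_on_const) auto
      qed
    qed (fact random_time)+
    also have "\<dots> = (CLINT \<omega>|M. complex_of_real (exp (- (u * B2 t \<omega>)\<^sup>2 / 2)))"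
    proof -
      \<comment> \<open>Self-similarity enters here: the exponents multiply to 2. The split isolates
        the value 0, where both sides vanish.\<close>
      have "S \<omega> powr (2 * H) = (B2 t \<omega>)\<^sup>2" for \<omega>
        using H by (cases "B2 t \<omega> = 0") (auto simp: S_def powr_powr powr_realpow)
      then show ?thesis by (simp add: power_mult_distrib)
    qed
    also have "\<dots> = (CLINT b|distr M lborel (B2 t). complex_of_real (exp (- (u * b)\<^sup>2 / 2)))"
      by (subst integral_distr) auto
    also have "\<dots> = char (distr (?N \<Otimes>\<^sub>M std_normal_distribution) borel (\<lambda>(b, z). b * z)) u"
      unfolding B2_distr using prob_space_normal_density[OF \<sigma>] by (subst char_normal_product) auto
    finally show ?thesis .
  qed
  moreover have "real_distribution (distr M borel ?J)"
    by (rule real_distribution_distr) measurable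
  moreover have "real_distribution (distr (?N \<Otimes>\<^sub>M std_normal_distribution) borel (\<lambda>(b, z). b * z))"
  proof -
    interpret N: prob_space ?N by (rule prob_space_normal_density) (rule \<sigma>)
    interpret Z: prob_space std_normal_distribution by (rule prob_space_normal_density) simp
    interpret P: pair_prob_space ?N std_normal_distribution ..
    show ?thesis by (rule P.real_distribution_distr) measurable
  qed
  \<comment> \<open>Equal characteristic functions determine the law, by Levy's uniqueness
    theorem.\<close>
  ultimately have "distr M borel ?J = distr (?N \<Otimes>\<^sub>M std_normal_distribution) borel (\<lambda>(b, z). b * z)"
    by (intro Levy_uniqueness ext)
  also have "\<dots> = density lborel (\<lambda>x. ennreal (p1 H x t))"
    unfolding \<sigma>_def using t by (rule distr_normal_product)
  also have "distr M borel ?J = distr M lborel ?J" by (rule distr_cong) auto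
  finally show ?thesis by (simp add: distributed_def)
qed

theorem theorem3p1:
  fixes M :: "'a measure" and H :: real and T :: "real set"
    and B1 B2 :: "real \<Rightarrow> 'a \<Rightarrow> real"
  assumes "prob_space M"
    and "0 < H" and "H < 1"
    and "{0..} \<subseteq> T"
    and "fractional_brownian_motion M H T B1"
    and "fractional_brownian_motion M H T B2"
    and "independent_processes M T B1 B2"
    and "\<And>\<omega>. \<omega> \<in> space M \<Longrightarrow> continuous_on T (\<lambda>t. B1 t \<omega>)"
  shows "(\<forall>t>0. distributed M lborel (iterated_fbm H B1 B2 t) (\<lambda>x. ennreal (p1 H x t)))
    \<and> (\<forall>x t. x \<noteq> 0 \<and> t > 0 \<longrightarrow>
          p1 H x t = 1 / (pi * t powr H) * bessel_K0 (\<bar>x\<bar> / t powr H))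
    \<and> (\<forall>x t. x \<noteq> 0 \<and> t > 0 \<longrightarrow>
          (\<lambda>\<tau>. p1 H x \<tau>) differentiable (at t)
        \<and> (\<forall>k<3. ((deriv ^^ k) (\<lambda>\<xi>. p1 H \<xi> t)) differentiable (at x))
        \<and> (\<forall>k<2. ((deriv ^^ k) (\<lambda>\<xi>. \<xi> * deriv (\<lambda>\<eta>. p1 H \<eta> t) \<xi>)) differentiable (at x))
        \<and> deriv (\<lambda>\<tau>. p1 H x \<tau>) t
            = - H * t powr (2 * H - 1) *
                (2 * (deriv ^^ 2) (\<lambda>\<xi>. p1 H \<xi> t) x + x * (deriv ^^ 3) (\<lambda>\<xi>. p1 H \<xi> t) x)
        \<and> - H * t powr (2 * H - 1) *
                (2 * (deriv ^^ 2) (\<lambda>\<xi>. p1 H \<xi> t) x + x * (deriv ^^ 3) (\<lambda>\<xi>. p1 H \<xi> t) x)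
            = - H * t powr (2 * H - 1) *
                (deriv ^^ 2) (\<lambda>\<xi>. \<xi> * deriv (\<lambda>\<eta>. p1 H \<eta> t) \<xi>) x)"
proof -
  have "distributed M lborel (iterated_fbm H B1 B2 t) (\<lambda>x. ennreal (p1 H x t))" if "0 < t" for t
    by (rule distributed_iterated_fbm[OF assms(1,2,4-8) that])
  moreover have "p1 H x t = 1 / (pi * t powr H) * bessel_K0 (\<bar>x\<bar> / t powr H)" if "0 < t" for x t
    using that by (rule p1_eq_bessel_K0)
  ultimately show ?thesis
    using p1_pde[where H = H] by blast
qed

end
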